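(* Let $H=(V,E)$ be a finite $3$-uniform hypergraph with $|V|\ge 2$ such that $d^+(v)\ge 3$ for all but at most one $v\in V$. Then $H$ contains a linear cycle.
   Context: A finite $3$-uniform hypergraph $H=(V,E)$ consists of a finite vertex set $V$ and a set $E$ of $3$-element subsets of $V$ (edges). For $v\in V$, the link of $v$ is the graph with vertex set $V$ and edge set $\{\{x,y\}: \{v,x,y\}\in E\}$. The strong degree $d^+(v)$ is the maximum number of pairwise disjoint edges in the link of $v$. A linear cycle in $H$ is a set of $k\ge 3$ edges of the form $\{v_i,w_i,v_{i+1}\}$, $i=1,\dots,k$ (indices modulo $k$), where $v_1,\dots,v_k,w_1,\dots,w_k$ are $2k$ distinct vertices. Thus only cyclically consecutive edges intersect, they intersect in exactly one vertex, and these intersection vertices are distinct. *)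

theory Defs
  imports Main
begin

definition three_uniform_hypergraph :: "'a set \<Rightarrow> 'a set set \<Rightarrow> bool" where
  "three_uniform_hypergraph V E \<longleftrightarrow> finite V \<and> (\<forall>e\<in>E. e \<subseteq> V \<and> card e = 3)"

text \<open>Only the edge set of the link is recorded; its vertex set is that of the hypergraph.
  In a 3-uniform hypergraph, \<open>{v, x, y} \<in> E\<close> forces \<open>v\<close>, \<open>x\<close>, \<open>y\<close> to be distinct,
  so every element of \<open>link_edges E v\<close> is a 2-element set.\<close>

definition link_edges :: "'a set set \<Rightarrow> 'a \<Rightarrow> 'a set set" where
  "link_edges E v = {{x, y} | x y. {v, x, y} \<in> E}"

text \<open>For finite \<open>E\<close> the maximum is over a finite set, nonempty because of the empty matching.\<close>

definition strong_degree :: "'a set set \<Rightarrow> 'a \<Rightarrow> nat" where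
  "strong_degree E v = Max {card M | M. M \<subseteq> link_edges E v \<and> pairwise disjnt M}"

text \<open>Indices are shifted to \<open>0, \<dots>, k - 1\<close>. The injectivity and disjointness conditions say
  that the \<open>2k\<close> vertices \<open>v i\<close>, \<open>w i\<close> are distinct; for \<open>k \<ge> 3\<close> the \<open>k\<close> listed edges are then
  distinct as well.\<close>

definition linear_cycle :: "'a set set \<Rightarrow> bool" where
  "linear_cycle C \<longleftrightarrow>
     (\<exists>k v w. 3 \<le> k \<and> inj_on v {..<k} \<and> inj_on w {..<k} \<and> v ` {..<k} \<inter> w ` {..<k} = {} \<and>
        C = {{v i, w i, v (Suc i mod k)} | i. i < k})"

end

theory Submission
  imports Defs
begin

text \<open>Three pairwise disjoint link edges at \<open>v\<close> guarantee that a linear path arriving at \<open>v\<close> can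
  always leave through an edge avoiding the two other vertices of the last edge. Without linear
  cycles, the first time such an edge meets the path again it must contain the pair
  \<open>{x, y}\<close> of an earlier edge \<open>{x, y, d}\<close> that the path left through \<open>d\<close>; this is a lollipop with
  base \<open>{x, y}\<close>. Entering at \<open>x\<close>, one leaves a lollipop through a suitable other vertex, and
  any later edge returning to it would close a linear cycle. So a depth-first
  search from the possibly exceptional vertex never gets stuck, contradicting finiteness.\<close>

section \<open>Edge chains as vertex lists\<close>

text \<open>A linear path is written as the list \<open>[d\<^sub>0, c\<^sub>1, d\<^sub>1, c\<^sub>2, d\<^sub>2, \<dots>]\<close> of its vertices, with edges
  \<open>{d\<^sub>i, c\<^sub>i\<^sub>+\<^sub>1, d\<^sub>i\<^sub>+\<^sub>1}\<close>; the last two vertices may be interchanged.\<close>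

fun chain :: "'a set set \<Rightarrow> 'a list \<Rightarrow> bool" where
  "chain E [] \<longleftrightarrow> False"
| "chain E [a] \<longleftrightarrow> True"
| "chain E [a, b] \<longleftrightarrow> False"
| "chain E (a # b # c # xs) \<longleftrightarrow> {a, b, c} \<in> E \<and> chain E (c # xs)"

text \<open>The hypothesis makes \<open>a\<close> a joint, not the middle vertex of an edge, so the
  edges split at \<open>a\<close>.\<close>

lemma chain_append_iff: "chain E (xs @ [a]) \<Longrightarrow> chain E (xs @ a # ys) \<longleftrightarrow> chain E (a # ys)"
  by (induction E xs rule: chain.induct) auto

lemma chain_rev: "chain E xs \<Longrightarrow> chain E (rev xs)"
proof (induction E xs rule: chain.induct)
  case (4 E a b c xs)
  then have "chain E (rev xs @ [c])" by simp
  moreover have "{c, b, a} \<in> E" using 4(2) by (simp add: insert_commute)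
  ultimately show ?case by (simp add: chain_append_iff)
qed auto

lemma chain_rev_iff [simp]: "chain E (rev xs) \<longleftrightarrow> chain E xs"
  using chain_rev[of E xs] chain_rev[of E "rev xs"] by auto

lemma chain_odd: "chain E xs \<Longrightarrow> odd (length xs)"
  by (induction E xs rule: chain.induct) auto

lemma chain_nth: "chain E xs \<Longrightarrow> Suc (Suc (2 * i)) < length xs \<Longrightarrow>
    {xs ! (2 * i), xs ! Suc (2 * i), xs ! Suc (Suc (2 * i))} \<in> E"
proof (induction E xs arbitrary: i rule: chain.induct)
  case (4 E a b c xs)
  then show ?case by (cases i) auto
qed auto

lemma chain_vertices: "chain E xs \<Longrightarrow> 3 \<le> length xs \<Longrightarrow> set xs \<subseteq> \<Union>E"
proof (induction E xs rule: chain.induct)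
  case (4 E a b c xs)
  have "set (c # xs) \<subseteq> \<Union>E"
  proof (cases xs)
    case (Cons d ys)
    then show ?thesis using 4 by (cases ys) auto
  qed (use 4(2) in \<open>auto intro!: bexI[of _ "{a, b, c}"]\<close>)
  moreover have "{a, b} \<subseteq> \<Union>E" using 4(2) by (auto intro!: bexI[of _ "{a, b, c}"])
  ultimately show ?case by simp
qed auto

text \<open>\<open>h\<close> will be the pair \<open>{\<alpha>, \<beta>}\<close> of a returning
  edge: walking up to the first edge it meets gives a path that avoids it.\<close>

lemma chain_first_hit:
  assumes "chain E xs" "hd xs \<notin> h" "h \<inter> set xs \<noteq> {}"
  shows "\<exists>A a b c C. xs = A @ a # b # c # C \<and> chain E (A @ [a]) \<and> {a, b, c} \<in> E \<and>
    chain E (c # C) \<and> h \<inter> set (A @ [a]) = {} \<and> (b \<in> h \<or> c \<in> h)"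
  using assms
proof (induction E xs rule: chain.induct)
  case (4 E a b c xs)
  show ?case
  proof (cases "b \<in> h \<or> c \<in> h")
    case True
    then show ?thesis using 4(2,3) by (intro exI[of _ "[]"]) auto
  next
    case False
    then have "chain E (c # xs)" "hd (c # xs) \<notin> h" "h \<inter> set (c # xs) \<noteq> {}"
      using 4(2-4) by auto
    from 4(1)[OF this] obtain A a' b' c' C where *: "c # xs = A @ a' # b' # c' # C" "chain E (A @ [a'])"
      "{a', b', c'} \<in> E" "chain E (c' # C)" "h \<inter> set (A @ [a']) = {}" "b' \<in> h \<or> c' \<in> h"
      by blast
    have "chain E (a # b # A @ [a'])" using *(1,2) 4(2) by (cases A) auto
    then show ?thesis using * False 4(2,3)
      by (intro exI[of _ "a # b # A"] exI[of _ a'] exI[of _ b'] exI[of _ c'] exI[of _ C]) auto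
  qed
qed auto

section \<open>Linear paths and linear cycles\<close>

definition linear_path :: "'a set set \<Rightarrow> 'a list \<Rightarrow> bool" where
  "linear_path E P \<longleftrightarrow> chain E P \<and> distinct P"

lemma linear_path_rev [simp]: "linear_path E (rev P) \<longleftrightarrow> linear_path E P"
  by (simp add: linear_path_def)

lemma linear_path_append:
  assumes "linear_path E P" "linear_path E Q" "last P = hd Q" "set P \<inter> set Q = {hd Q}"
  shows "linear_path E (P @ tl Q)" "hd (P @ tl Q) = hd P" "last (P @ tl Q) = last Q"
    "set (P @ tl Q) = set P \<union> set Q" "length (P @ tl Q) = length P + length Q - 1"
proof -
  have "P \<noteq> []" "Q \<noteq> []" using assms(1,2) by (auto simp: linear_path_def)
  then obtain P' a Q' where PQ: "P = P' @ [a]" "Q = a # Q'"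
    using assms(3) by (metis append_butlast_last_id list.collapse)
  show "linear_path E (P @ tl Q)"
    using assms unfolding PQ linear_path_def by (auto simp: chain_append_iff)
  show "hd (P @ tl Q) = hd P" "last (P @ tl Q) = last Q"
    "set (P @ tl Q) = set P \<union> set Q" "length (P @ tl Q) = length P + length Q - 1"
    unfolding PQ by (cases P'; auto)+
qed

text \<open>Five vertices carry two edges, so the closing edge is at least the third. Joints, at
  even indices, become \<open>v\<close>; the middle vertices and finally \<open>s\<close> become
  \<open>w\<close>.\<close>

lemma linear_cycle_of_path:
  assumes "linear_path E P" "5 \<le> length P" "{last P, s, hd P} \<in> E" "s \<notin> set P"
  shows "\<exists>C. C \<subseteq> E \<and> linear_cycle C"
proof -
  obtain k where k: "length P = Suc (2 * k)"
    using assms(1) chain_odd[of E P] by (auto simp: linear_path_def elim: oddE)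
  have dist: "distinct P" and ch: "chain E P" using assms(1) by (auto simp: linear_path_def)
  define v where "v i = P ! (2 * i)" for i
  define w where "w i = (if i < k then P ! Suc (2 * i) else s)" for i
  have inj: "i = j" if "P ! i = P ! j" "i < length P" "j < length P" for i j
    using that dist by (simp add: nth_eq_iff_index_eq)
  have "inj_on v {..<Suc k}"
    by (rule inj_onI) (auto simp: v_def k dest!: inj)
  moreover have "inj_on w {..<Suc k}"
  proof (rule inj_onI)
    fix i j assume "i \<in> {..<Suc k}" "j \<in> {..<Suc k}" "w i = w j"
    then show "i = j" using assms(4) inj[of "Suc (2 * i)" "Suc (2 * j)"] k
      by (auto simp: w_def split: if_splits)
  qed
  moreover have "v ` {..<Suc k} \<inter> w ` {..<Suc k} = {}"
  proof -
    have "v i \<noteq> w j" if "i < Suc k" "j < Suc k" for i j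
    proof (cases "j < k")
      case True
      have "2 * i \<noteq> Suc (2 * j)" by presburger
      then show ?thesis using inj[of "2 * i" "Suc (2 * j)"] that True k by (auto simp: v_def w_def)
    next
      case False
      have "v i \<in> set P" using that k by (auto simp: v_def)
      then show ?thesis using False assms(4) by (auto simp: w_def)
    qed
    then show ?thesis by auto
  qed
  moreover have "3 \<le> Suc k" using assms(2) k by simp
  ultimately have cyc: "linear_cycle {{v i, w i, v (Suc i mod Suc k)} | i. i < Suc k}"
    unfolding linear_cycle_def by blast
  have "{v i, w i, v (Suc i mod Suc k)} \<in> E" if "i < Suc k" for i
  proof (cases "i < k")
    case True
    then show ?thesis using chain_nth[OF ch, of i] k by (simp add: v_def w_def)
  next
    case False
    with that have "i = k" by simp
    moreover have "P \<noteq> []" using k by auto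
    ultimately show ?thesis using assms(3) k
      by (simp add: v_def w_def last_conv_nth hd_conv_nth)
  qed
  then have "{{v i, w i, v (Suc i mod Suc k)} | i. i < Suc k} \<subseteq> E" by auto
  then show ?thesis using cyc by (intro exI conjI)
qed

section \<open>Gadgets and lollipops\<close>

text \<open>If a linear path leaves \<open>B\<close> through \<open>w\<close> and its end lies in an edge whose other vertices are
  \<open>\<alpha> \<in> B\<close> and \<open>\<beta>\<close>, the path \<open>P\<close> inside \<open>B\<close> closes a linear cycle. The two alternatives cover
  \<open>\<beta> \<in> B\<close>, where the end of \<open>P\<close> may be either vertex of the edge.\<close>

definition gadget :: "'a set set \<Rightarrow> 'a set \<Rightarrow> 'a \<Rightarrow> bool" where
  "gadget E B w \<longleftrightarrow> w \<in> B \<and>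
     (\<forall>\<alpha> \<beta>. \<alpha> \<in> B \<longrightarrow> \<alpha> \<noteq> w \<longrightarrow> \<beta> \<noteq> w \<longrightarrow> \<alpha> \<noteq> \<beta> \<longrightarrow>
       (\<exists>P. linear_path E P \<and> set P \<subseteq> B \<and> last P = w \<and>
         (hd P = \<alpha> \<and> \<beta> \<notin> set P \<or> hd P = \<beta> \<and> \<alpha> \<notin> set P)))"

text \<open>The edges \<open>{x, y, hd D}\<close> and \<open>{last D, x, y}\<close> share the base
  \<open>{x, y}\<close>, so the closed chain is not a linear cycle. The length bound gives
  \<open>D\<close> an edge of its own, hence two different ends.\<close>

definition lollipop :: "'a set set \<Rightarrow> 'a \<Rightarrow> 'a \<Rightarrow> 'a list \<Rightarrow> bool" where
  "lollipop E x y D \<longleftrightarrow> linear_path E (x # y # D) \<and> {last D, x, y} \<in> E \<and> 3 \<le> length D"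

lemma lollipop_rev:
  assumes "lollipop E x y D" shows "lollipop E x y (rev D)"
proof -
  obtain a b c D' where D: "D = a # b # c # D'"
    using assms by (auto simp: lollipop_def Suc_le_length_iff numeral_3_eq_3)
  have ch: "chain E D" and e: "{x, y, hd D} \<in> E" "{last D, x, y} \<in> E"
    using assms by (auto simp: lollipop_def linear_path_def D)
  have "chain E (rev D)" using ch by simp
  moreover have "rev D = last D # tl (rev D)" using D by (metis hd_rev list.collapse list.distinct(1) rev_is_Nil_conv)
  ultimately have "chain E (x # y # rev D)"
    using e(2) by (metis chain.simps(4) insert_commute)
  then show ?thesis using assms e(1) ch
    by (auto simp: lollipop_def linear_path_def last_rev insert_commute)
qed

lemma lollipop_chains:
  assumes "lollipop E x y D"
  shows "chain E D" "distinct D" "x \<noteq> y" "x \<notin> set D" "y \<notin> set D" "{x, y, hd D} \<in> E"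
    "{last D, x, y} \<in> E" "3 \<le> length D" "hd D \<noteq> last D"
proof -
  obtain a b c D' where D: "D = a # b # c # D'"
    using assms by (auto simp: lollipop_def Suc_le_length_iff numeral_3_eq_3)
  show "chain E D" "distinct D" "x \<noteq> y" "x \<notin> set D" "y \<notin> set D" "{x, y, hd D} \<in> E"
    "{last D, x, y} \<in> E" "3 \<le> length D" "hd D \<noteq> last D"
    using assms by (auto simp: lollipop_def linear_path_def D)
qed

text \<open>Two routes join \<open>y\<close> to the edge \<open>{a, b, c}\<close>: through
  \<open>x\<close> and \<open>A\<close>, ending at \<open>c\<close> or \<open>b\<close>, or
  backwards over the closing edge and \<open>C\<close>, ending at \<open>c\<close>.\<close>

lemma lollipop_prefix:
  assumes "lollipop E x y (A @ a # b # c # C)" "chain E (A @ [a])"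
    "{a, b, c} \<in> E" "chain E (c # C)"
  shows "linear_path E (y # x # A @ [a, b, c])" "linear_path E (y # x # A @ [a, c, b])"
    "linear_path E (c # C @ [x, y])"
proof -
  note l = lollipop_chains[OF assms(1)]
  have 1: "chain E (A @ [a, b, c])" "chain E (A @ [a, c, b])"
    using assms(2,3) by (auto simp: chain_append_iff insert_commute)
  have "{y, x, hd (A @ [a])} \<in> E" using l(6) by (cases A) (auto simp: insert_commute)
  then have "chain E (y # x # A @ [a, b, c])" "chain E (y # x # A @ [a, c, b])"
    using 1 by (cases A; auto)+
  then show "linear_path E (y # x # A @ [a, b, c])" "linear_path E (y # x # A @ [a, c, b])"
    using l by (auto simp: linear_path_def)
  obtain C' z where C': "c # C = C' @ [z]" by (metis append_butlast_last_id list.distinct(1))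
  have "{z, x, y} \<in> E" using l(7) C' by (metis last_appendR last_snoc list.distinct(1) last_ConsR)
  then have "chain E (C' @ z # [x, y])" using assms(4) C' by (subst chain_append_iff) auto
  then have "chain E (c # C @ [x, y])" using C' by (metis append.assoc append_Cons append_Nil)
  then show "linear_path E (c # C @ [x, y])" using l by (auto simp: linear_path_def)
qed

text \<open>Take the first edge of \<open>D\<close> that meets \<open>{\<alpha>, \<beta>}\<close>.
  If it contains only one of them, the route through \<open>A\<close> avoids the other; if both, the
  route from \<open>c\<close> along \<open>C\<close> avoids \<open>b\<close>. From \<open>x\<close>
  or \<open>hd D\<close> a single base edge suffices.\<close>

lemma lollipop_gadget:
  assumes "lollipop E x y D"
  shows "gadget E (set (x # y # D)) y"
proof -
  note l = lollipop_chains[OF assms]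
  have Dne: "D \<noteq> []" using l(8) by auto
  have xp: "linear_path E [x, hd D, y]" "linear_path E [x, last D, y]" "linear_path E [hd D, x, y]"
    using l Dne by (auto simp: linear_path_def insert_commute)
  let ?ex = "\<lambda>\<alpha> \<beta>. \<exists>P. linear_path E P \<and> set P \<subseteq> set (x # y # D) \<and> last P = y \<and> hd P = \<alpha> \<and> \<beta> \<notin> set P"
  \<comment> \<open>The two base edges have different third vertices, so one of them avoids
    \<beta>.\<close>
  have x: "?ex x \<beta>" if "\<beta> \<noteq> x" "\<beta> \<noteq> y" for \<beta>
  proof (cases "\<beta> = hd D")
    case True
    then show ?thesis using xp(2) that l(9) Dne by (intro exI[of _ "[x, last D, y]"]) auto
  next
    case False
    then show ?thesis using xp(1) that Dne by (intro exI[of _ "[x, hd D, y]"]) auto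
  qed
  have hd: "?ex (hd D) \<beta>" if "\<beta> \<noteq> hd D" "\<beta> \<noteq> x" "\<beta> \<noteq> y" for \<beta>
    using xp(3) that Dne by (intro exI[of _ "[hd D, x, y]"]) auto
  have D: "?ex \<alpha> \<beta> \<or> ?ex \<beta> \<alpha>" if "\<alpha> \<in> set D" "\<beta> \<noteq> \<alpha>" "\<beta> \<noteq> x" "\<beta> \<noteq> y" for \<alpha> \<beta>
  proof (cases "hd D \<in> {\<alpha>, \<beta>}")
    case True
    then show ?thesis using hd[of \<alpha>] hd[of \<beta>] that l(4,5) by fastforce
  next
    case False
    with that obtain A a b c C where *: "D = A @ a # b # c # C" "chain E (A @ [a])" "{a, b, c} \<in> E"
      "chain E (c # C)" "{\<alpha>, \<beta>} \<inter> set (A @ [a]) = {}" "b \<in> {\<alpha>, \<beta>} \<or> c \<in> {\<alpha>, \<beta>}"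
      using chain_first_hit[OF l(1), of "{\<alpha>, \<beta>}"] by blast
    note pre = lollipop_prefix[OF assms[unfolded *(1)] *(2,3,4)]
    have dist: "distinct (A @ a # b # c # C)" using l(2) *(1) by simp
    have c1: "?ex c z" if "z \<notin> set (A @ [a])" "z \<noteq> b" "z \<noteq> c" "z \<noteq> x" "z \<noteq> y" for z
      using that *(1) linear_path_rev[of E "y # x # A @ [a, b, c]"] pre(1)
      by (intro exI[of _ "rev (y # x # A @ [a, b, c])"]) auto
    have b1: "?ex b z" if "z \<notin> set (A @ [a])" "z \<noteq> b" "z \<noteq> c" "z \<noteq> x" "z \<noteq> y" for z
      using that *(1) linear_path_rev[of E "y # x # A @ [a, c, b]"] pre(2)
      by (intro exI[of _ "rev (y # x # A @ [a, c, b])"]) auto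
    have c2: "?ex c b"
      using *(1) pre(3) dist l(4,5) by (intro exI[of _ "c # C @ [x, y]"]) auto
    have "\<alpha> \<noteq> x" "\<alpha> \<noteq> y" using that(1) l(4,5) by auto
    moreover have "\<alpha> \<notin> set (A @ [a])" "\<beta> \<notin> set (A @ [a])" using *(5) by auto
    ultimately show ?thesis using *(6) that(2-4) c1 b1 c2 by blast
  qed
  show ?thesis unfolding gadget_def
  proof (intro conjI allI impI)
    fix \<alpha> \<beta> assume a: "\<alpha> \<in> set (x # y # D)" "\<alpha> \<noteq> y" "\<beta> \<noteq> y" "\<alpha> \<noteq> \<beta>"
    then consider "\<alpha> = x" | "\<beta> = x" | "\<alpha> \<in> set D" "\<beta> \<noteq> x" by auto
    then have "?ex \<alpha> \<beta> \<or> ?ex \<beta> \<alpha>"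
      by cases (use a x D in auto)
    then show "\<exists>P. linear_path E P \<and> set P \<subseteq> set (x # y # D) \<and> last P = y \<and>
        (hd P = \<alpha> \<and> \<beta> \<notin> set P \<or> hd P = \<beta> \<and> \<alpha> \<notin> set P)" by blast
  qed simp
qed

section \<open>Matchings in the link\<close>

definition three_matching :: "'a set set \<Rightarrow> 'a \<Rightarrow> bool" where
  "three_matching E v \<longleftrightarrow> (\<exists>M. M \<subseteq> link_edges E v \<and> pairwise disjnt M \<and> card M = 3)"

text \<open>A vertex lies in at most one of three disjoint link edges, so two of them avoid
  \<open>x\<close>.\<close>

lemma three_matching_two_edges:
  assumes "three_matching E v"
  obtains p q p' q' where "{v, p, q} \<in> E" "{v, p', q'} \<in> E" "{p, q} \<inter> {p', q'} = {}"
    "x \<notin> {p, q}" "x \<notin> {p', q'}"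
proof -
  note ob = that
  obtain M where M: "M \<subseteq> link_edges E v" "pairwise disjnt M" "card M = 3"
    using assms by (auto simp: three_matching_def)
  obtain A B C where ABC: "M = {A, B, C}" "A \<noteq> B" "B \<noteq> C" "A \<noteq> C"
    using M(3) by (auto simp: card_3_iff)
  have d: "A \<inter> B = {}" "B \<inter> C = {}" "A \<inter> C = {}"
    using M(2) ABC by (auto simp: pairwise_def disjnt_def)
  have *: thesis if S: "S \<in> M" "S' \<in> M" "S \<inter> S' = {}" "x \<notin> S" "x \<notin> S'" for S S'
  proof -
    obtain p q where "S = {p, q}" "{v, p, q} \<in> E"
      using S(1) M(1) by (auto simp: link_edges_def)
    moreover obtain p' q' where "S' = {p', q'}" "{v, p', q'} \<in> E"
      using S(2) M(1) by (auto simp: link_edges_def)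
    ultimately show thesis using S ob[of p q p' q'] by simp
  qed
  show thesis
  proof (cases "x \<in> A")
    case True
    then show ?thesis using *[of B C] d ABC by blast
  next
    case False
    then show ?thesis using *[of A B] *[of A C] d ABC by blast
  qed
qed

lemma three_matching_edge:
  assumes "three_matching E v"
  obtains p q where "{v, p, q} \<in> E" "{p, q} \<inter> {x, y} = {}"
proof -
  note ob = that
  obtain p q p' q' where *: "{v, p, q} \<in> E" "{v, p', q'} \<in> E" "{p, q} \<inter> {p', q'} = {}"
    "x \<notin> {p, q}" "x \<notin> {p', q'}"
    using three_matching_two_edges[OF assms] .
  show thesis
    by (cases "y \<in> {p, q}") (use * ob[of p q] ob[of p' q'] in auto)
qed

lemma strong_degree_three_matching:
  assumes "three_uniform_hypergraph V E" "strong_degree E v \<ge> 3"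
  shows "three_matching E v"
proof -
  let ?S = "{card M | M. M \<subseteq> link_edges E v \<and> pairwise disjnt M}"
  have "link_edges E v \<subseteq> Pow V"
    using assms(1) by (auto simp: link_edges_def three_uniform_hypergraph_def)
  then have fin: "finite (link_edges E v)"
    using assms(1) by (metis finite_Pow_iff finite_subset three_uniform_hypergraph_def)
  have "?S \<subseteq> card ` Pow (link_edges E v)" by auto
  then have "finite ?S" using fin by (meson finite_Pow_iff finite_imageI finite_subset)
  moreover have "?S \<noteq> {}" by (auto intro!: exI[of _ "{}"])
  ultimately have "strong_degree E v \<in> ?S" unfolding strong_degree_def by (rule Max_in)
  then obtain M where M: "M \<subseteq> link_edges E v" "pairwise disjnt M" "3 \<le> card M"
    using assms(2) by auto
  then obtain M' where "M' \<subseteq> M" "card M' = 3" by (meson obtain_subset_with_card_n)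
  then show ?thesis using M unfolding three_matching_def by (meson pairwise_subset subset_trans)
qed

section \<open>Lollipops without linear cycles\<close>

locale linear_cycle_free =
  fixes E :: "'a set set"
  assumes uniform: "e \<in> E \<Longrightarrow> card e = 3"
    and no_linear_cycle: "\<nexists>C. C \<subseteq> E \<and> linear_cycle C"
begin

lemma edge_distinct: "{a, b, c} \<in> E \<Longrightarrow> a \<noteq> b \<and> b \<noteq> c \<and> a \<noteq> c"
  using uniform[of "{a, b, c}"] by (auto simp: card_insert_if split: if_splits)

lemma no_closing_edge:
  "linear_path E P \<Longrightarrow> 5 \<le> length P \<Longrightarrow> {last P, s, hd P} \<in> E \<Longrightarrow> s \<in> set P"
  using linear_cycle_of_path[of E P s] no_linear_cycle by argo

text \<open>Take the first edge \<open>{a, b, c}\<close> of \<open>D\<close> that is met. If only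
  one of \<open>b\<close>, \<open>c\<close> is met, the route from \<open>y\<close> through
  \<open>A\<close> closes to a linear cycle. If both are and \<open>C\<close> is nonempty, the route
  along \<open>C\<close> closes with \<open>b\<close> off it. So \<open>{b, c}\<close> ends
  \<open>D\<close>.\<close>

lemma lollipop_hit_end:
  assumes L: "lollipop E x y D" and h: "{y, \<alpha>, \<beta>} \<in> E" "x \<notin> {\<alpha>, \<beta>}" "{\<alpha>, \<beta>} \<inter> set D \<noteq> {}"
    and hd: "hd D \<notin> {\<alpha>, \<beta>}"
  shows "{\<alpha>, \<beta>} = {last D, last (butlast D)}"
proof -
  note l = lollipop_chains[OF L]
  obtain A a b c C where *: "D = A @ a # b # c # C" "chain E (A @ [a])" "{a, b, c} \<in> E"
    "chain E (c # C)" "{\<alpha>, \<beta>} \<inter> set (A @ [a]) = {}" "b \<in> {\<alpha>, \<beta>} \<or> c \<in> {\<alpha>, \<beta>}"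
    using chain_first_hit[OF l(1) hd h(3)] by blast
  note pre = lollipop_prefix[OF L[unfolded *(1)] *(2,3,4)]
  have dist: "distinct (A @ a # b # c # C)" using l(2) *(1) by simp
  have ed: "y \<noteq> \<alpha>" "y \<noteq> \<beta>" "\<alpha> \<noteq> \<beta>" using edge_distinct[OF h(1)] by auto
  have "c = z" if "{\<alpha>, \<beta>} = {b, z}" for z
  proof -
    have "{b, z, y} \<in> E" using h(1) that by (simp add: insert_commute)
    then have "z \<in> set (y # x # A @ [a, c, b])"
      using no_closing_edge[OF pre(2), of z] by simp
    moreover have "z \<in> {\<alpha>, \<beta>}" "z \<noteq> b" using that ed by (auto simp: doubleton_eq_iff)
    moreover have "z \<notin> set (A @ [a])" "z \<noteq> x" "z \<noteq> y" using *(5) h(2) ed calculation(2) by auto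
    ultimately show ?thesis by auto
  qed
  moreover have "b = z" if "{\<alpha>, \<beta>} = {c, z}" for z
  proof -
    have "{c, z, y} \<in> E" using h(1) that by (simp add: insert_commute)
    then have "z \<in> set (y # x # A @ [a, b, c])"
      using no_closing_edge[OF pre(1), of z] by simp
    moreover have "z \<in> {\<alpha>, \<beta>}" "z \<noteq> c" using that ed by (auto simp: doubleton_eq_iff)
    moreover have "z \<notin> set (A @ [a])" "z \<noteq> x" "z \<noteq> y" using *(5) h(2) ed calculation(2) by auto
    ultimately show ?thesis by auto
  qed
  ultimately have bc: "{\<alpha>, \<beta>} = {b, c}" using *(6) by auto
  have "C = []"
  proof (rule ccontr)
    assume "C \<noteq> []"
    moreover have "even (length C)" using chain_odd[OF *(4)] by simp
    ultimately have "2 \<le> length C" by (cases C rule: list.exhaust; cases "tl C") auto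
    moreover have "{y, b, c} \<in> E" using h(1) bc by (metis insert_is_Un)
    ultimately have "b \<in> set (c # C @ [x, y])"
      using no_closing_edge[OF pre(3), of b] by simp
    then show False using dist l(4,5) *(1) by auto
  qed
  then show ?thesis using bc *(1) by (simp add: butlast_append insert_commute)
qed

text \<open>If an end of \<open>D\<close> is missed, \<open>lollipop_hit_end\<close> applies to
  \<open>D\<close> or its reversal. If both ends are hit, the edge closes \<open>D\<close> itself
  unless \<open>D\<close> is a single edge.\<close>

lemma lollipop_hit:
  assumes L: "lollipop E x y D" and h: "{y, \<alpha>, \<beta>} \<in> E" "x \<notin> {\<alpha>, \<beta>}" "{\<alpha>, \<beta>} \<inter> set D \<noteq> {}"
  shows "{\<alpha>, \<beta>} = {hd D, hd (tl D)} \<or> {\<alpha>, \<beta>} = {last D, last (butlast D)} \<or>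
    length D = 3 \<and> {\<alpha>, \<beta>} = {hd D, last D}"
proof -
  note l = lollipop_chains[OF L]
  have D: "D \<noteq> []" "tl D \<noteq> []" using l(8) by (auto simp: Suc_le_length_iff numeral_3_eq_3)
  have "{\<alpha>, \<beta>} = {hd D, last D}" if "hd D \<in> {\<alpha>, \<beta>}" "last D \<in> {\<alpha>, \<beta>}"
    using that l(9) by auto
  then consider "hd D \<notin> {\<alpha>, \<beta>}" | "last D \<notin> {\<alpha>, \<beta>}" | "{\<alpha>, \<beta>} = {hd D, last D}"
    by argo
  then show ?thesis
  proof cases
    case 1
    then show ?thesis using lollipop_hit_end[OF L h] by simp
  next
    case 2
    then have "{\<alpha>, \<beta>} = {last (rev D), last (butlast (rev D))}"
      using lollipop_hit_end[OF lollipop_rev[OF L] h(1,2)] h(3) D by (simp add: hd_rev)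
    then show ?thesis using D by (simp add: last_rev butlast_rev)
  next
    case 3
    have "linear_path E D" using l by (simp add: linear_path_def)
    moreover have "{last D, y, hd D} \<in> E" using h(1) 3 by (simp add: insert_commute)
    ultimately have "\<not> 5 \<le> length D" using no_closing_edge[of D y] l(5) by blast
    then have "length D = 3" using l(8) chain_odd[OF l(1)] by presburger
    then show ?thesis using 3 by simp
  qed
qed

text \<open>Take two disjoint link edges at \<open>y\<close> avoiding \<open>x\<close>. If neither
  gives an exit, both are pairs allowed by \<open>lollipop_hit\<close>. Three vertices cannot hold
  two disjoint pairs, so \<open>D\<close> is longer and the pairs sit at its two ends.\<close>

lemma lollipop_exit_or_hinges:
  assumes L: "lollipop E x y D" and m: "three_matching E y"
  shows "(\<exists>p q. {y, p, q} \<in> E \<and> {p, q} \<inter> set (x # y # D) = {}) \<or>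
    5 \<le> length D \<and> {y, hd D, hd (tl D)} \<in> E \<and> {y, last D, last (butlast D)} \<in> E"
proof -
  note l = lollipop_chains[OF L]
  obtain p q p' q' where e: "{y, p, q} \<in> E" "{y, p', q'} \<in> E" and d: "{p, q} \<inter> {p', q'} = {}"
    and x: "x \<notin> {p, q}" "x \<notin> {p', q'}"
    using three_matching_two_edges[OF m] .
  have ed: "y \<notin> {p, q}" "y \<notin> {p', q'}" "p \<noteq> q" "p' \<noteq> q'" using edge_distinct e by blast+
  show ?thesis
  proof (cases "{p, q} \<inter> set D = {} \<or> {p', q'} \<inter> set D = {}")
    case True
    then show ?thesis using e x ed by (auto 4 4)
  next
    case False
    then have a: "{p, q} \<inter> set D \<noteq> {}" "{p', q'} \<inter> set D \<noteq> {}" by auto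
    note c = lollipop_hit[OF L e(1) x(1) a(1)] lollipop_hit[OF L e(2) x(2) a(2)]
    show ?thesis
    proof (cases "length D = 3")
      case True
      then obtain u v w where "D = [u, v, w]" by (auto simp: numeral_3_eq_3 length_Suc_conv)
      then have "{p, q} \<subseteq> {u, v, w}" "{p', q'} \<subseteq> {u, v, w}" using c by auto
      then have "{p, q} \<union> {p', q'} \<subseteq> {u, v, w}" by blast
      then have "card ({p, q} \<union> {p', q'}) \<le> 3"
        using card_mono[of "{u, v, w}" "{p, q} \<union> {p', q'}"] card_length[of "[u, v, w]"] by simp
      then show ?thesis using d ed by (subst (asm) card_Un_disjoint) auto
    next
      case False
      then have "5 \<le> length D" using l(8) chain_odd[OF l(1)] by presburger
      moreover have "{p, q} \<noteq> {p', q'}" using d by auto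
      then have "{p, q} = {hd D, hd (tl D)} \<and> {p', q'} = {last D, last (butlast D)} \<or>
        {p', q'} = {hd D, hd (tl D)} \<and> {p, q} = {last D, last (butlast D)}"
        using c False by metis
      ultimately show ?thesis using e by (metis)
    qed
  qed
qed

text \<open>If no exit exists at \<open>b\<close>, the edge \<open>{b, d, c}\<close> with \<open>d\<close>, \<open>c\<close> the first two vertices of
  \<open>rest\<close> turns the same vertex set, rotated by two places, into a lollipop with base \<open>{d, c}\<close>. The
  closing edges of the successive lollipops form the path \<open>M\<close>, which the second edge at \<open>hd M\<close>
  finally closes to a linear cycle.\<close>

lemma rotated_lollipop_exit:
  assumes "lollipop E a b (rest @ x # M)" "M \<noteq> []" "chain E M" "odd (length rest)"
    "4 \<le> length M + length rest" "{hd M, last rest, last (butlast (b # rest))} \<in> E"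
    "\<forall>v \<in> set (a # b # rest @ M). three_matching E v"
    "B = set (a # b # rest @ x # M)"
  shows "\<exists>w p q. w \<in> B \<and> w \<noteq> x \<and> gadget E B w \<and> {w, p, q} \<in> E \<and> {p, q} \<inter> B = {}"
  using assms
proof (induction "length rest" arbitrary: a b rest M rule: less_induct)
  case less
  note L = less.prems(1)
  note l = lollipop_chains[OF L]
  have path: "linear_path E (a # b # rest @ x # M)" using L by (simp add: lollipop_def)
  then have dist: "distinct (a # b # rest @ x # M)" by (simp add: linear_path_def)
  have last: "{last M, a, b} \<in> E" using l(7) less.prems(2) by simp
  obtain M' z where M: "M = M' @ [z]" using less.prems(2) by (meson rev_exhaust)
  have chainM: "chain E (xs @ M @ [a, b])" if "chain E (xs @ M)" for xs
    using that last chain_append_iff[of E "xs @ M'" z "[a, b]"] by (simp add: M)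
  consider p q where "{b, p, q} \<in> E" "{p, q} \<inter> set (a # b # rest @ x # M) = {}"
    | "{b, hd (rest @ x # M), hd (tl (rest @ x # M))} \<in> E"
    using lollipop_exit_or_hinges[OF L] less.prems(7) by auto
  then show ?case
  proof cases
    case 1
    then show ?thesis using lollipop_gadget[OF L] dist unfolding less.prems(8)
      by (intro exI[of _ b] exI[of _ p] exI[of _ q]) auto
  next
    case 2
    obtain d rest1 where r1: "rest = d # rest1" using less.prems(4) by (cases rest) auto
    show ?thesis
    proof (cases rest1)
      case Nil
      \<comment> \<open>Only \<open>d\<close> is left before \<open>x\<close>, so the edge kept at
        \<open>hd M\<close> is \<open>{hd M, d, b}\<close>, which closes this path.\<close>
      have "linear_path E (M @ [a, b])"
        using chainM[of "[]"] less.prems(3) dist by (auto simp: linear_path_def)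
      moreover have "5 \<le> length (M @ [a, b])" using less.prems(5) r1 Nil by simp
      moreover have "{last (M @ [a, b]), d, hd (M @ [a, b])} \<in> E"
        using less.prems(2,6) r1 Nil by (simp add: insert_commute)
      ultimately have "d \<in> set (M @ [a, b])" by (rule no_closing_edge)
      then show ?thesis using dist r1 by auto
    next
      case (Cons c rest')
      have ne: "rest' \<noteq> []" "odd (length rest')" using less.prems(4) r1 Cons by auto
      \<comment> \<open>Moving \<open>a\<close>, \<open>b\<close> to the end uses the old closing
        edge as an edge of the path and \<open>{b, d, c}\<close> as the new closing edge. The edge
        kept at \<open>hd M\<close> and the sum of the lengths of \<open>M\<close> and
        \<open>rest\<close> do not change.\<close>
      have "chain E ((d # c # rest' @ [x]) @ M)" using path r1 Cons by (simp add: linear_path_def)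
      from chainM[OF this] have "linear_path E (d # c # rest' @ x # M @ [a, b])"
        using dist r1 Cons by (auto simp: linear_path_def)
      moreover have "{b, d, c} \<in> E" using 2 r1 Cons by simp
      ultimately have "lollipop E d c (rest' @ x # M @ [a, b])"
        using ne by (simp add: lollipop_def)
      moreover have "{hd (M @ [a, b]), last rest', last (butlast (c # rest'))} \<in> E"
        using less.prems(2,6) r1 Cons ne by simp
      ultimately show ?thesis
        using less.prems(2-5,7,8) r1 Cons ne chainM[of "[]"]
        by (intro less.hyps[of rest' d c "M @ [a, b]"]) auto
    qed
  qed
qed

text \<open>If \<open>y\<close> has no exit, its front hinge closes the lollipop rotated to begin
  with \<open>D\<close>, where \<open>M = [y]\<close>; its other hinge is the edge kept at
  \<open>hd M\<close>. The vertex \<open>x\<close> is excluded as exit because the search enters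
  there.\<close>

lemma lollipop_exit:
  assumes L: "lollipop E x y D" and m: "\<forall>v \<in> set (y # D). three_matching E v"
    and B: "B = set (x # y # D)"
  shows "\<exists>w p q. w \<in> B \<and> w \<noteq> x \<and> gadget E B w \<and> {w, p, q} \<in> E \<and> {p, q} \<inter> B = {}"
proof -
  note l = lollipop_chains[OF L]
  consider p q where "{y, p, q} \<in> E" "{p, q} \<inter> set (x # y # D) = {}"
    | "5 \<le> length D" "{y, hd D, hd (tl D)} \<in> E" "{y, last D, last (butlast D)} \<in> E"
    using lollipop_exit_or_hinges[OF L] m by auto
  then show ?thesis
  proof cases
    case 1
    then show ?thesis using lollipop_gadget[OF L] l(3) unfolding B
      by (intro exI[of _ y] exI[of _ p] exI[of _ q]) auto
  next
    case 2
    obtain a b rest where D: "D = a # b # rest"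
      using 2(1) by (auto simp: Suc_le_length_iff numeral_eq_Suc)
    then have len: "3 \<le> length rest" "rest \<noteq> []" using 2(1) by auto
    obtain D' z where D': "D = D' @ [z]" using l(8) by (cases D rule: rev_exhaust) auto
    have "chain E (D @ [x, y])"
      using chain_append_iff[of E D' z "[x, y]"] l(1,7) D' by simp
    then have "linear_path E (a # b # rest @ [x, y])"
      using l D by (auto simp: linear_path_def)
    moreover have "{y, a, b} \<in> E" using 2(2) D by simp
    ultimately have "lollipop E a b (rest @ x # [y])" using len by (simp add: lollipop_def)
    then show ?thesis
      by (rule rotated_lollipop_exit) (use 2(3) D len m B chain_odd[OF l(1)] in auto)
  qed
qed

section \<open>The depth-first search\<close>

text \<open>\<open>R\<close> is the set of vertices used by the search so far and \<open>t\<close> its current end. \<open>S\<close> contains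
  the bases \<open>{x, y}\<close> of those edges at which a lollipop may still be closed.\<close>

definition blocked :: "'a set \<Rightarrow> 'a \<Rightarrow> 'a set set \<Rightarrow> bool" where
  "blocked R t S \<longleftrightarrow> (\<forall>Q \<alpha> \<beta>. linear_path E Q \<longrightarrow> hd Q = t \<longrightarrow> 3 \<le> length Q \<longrightarrow> set Q \<inter> R = {t} \<longrightarrow>
     {last Q, \<alpha>, \<beta>} \<in> E \<longrightarrow> {\<alpha>, \<beta>} \<inter> set Q = {} \<longrightarrow> {\<alpha>, \<beta>} \<inter> R \<noteq> {} \<longrightarrow> {\<alpha>, \<beta>} \<in> S)"

text \<open>The search is shown to reach a pair in \<open>S\<close> eventually, which is absurd for
  \<open>S = {}\<close>.\<close>

definition returns :: "'a set \<Rightarrow> 'a \<Rightarrow> 'a set set \<Rightarrow> bool" where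
  "returns R t S \<longleftrightarrow> (\<exists>Q \<alpha> \<beta>. linear_path E Q \<and> hd Q = t \<and> 3 \<le> length Q \<and> set Q \<inter> R = {t} \<and>
     {last Q, \<alpha>, \<beta>} \<in> E \<and> {\<alpha>, \<beta>} \<in> S)"

text \<open>\<open>Q\<close> meets the earlier vertices, all in \<open>R'\<close>, only at its
  start, so the joined path still meets \<open>R\<close> in \<open>t\<close> alone.\<close>

lemma path_extend:
  assumes P: "linear_path E P" "hd P = t" "3 \<le> length P" "set P \<inter> R = {t}"
    and Q: "linear_path E Q" "hd Q = last P" "3 \<le> length Q" "set Q \<inter> R' = {last P}"
    and R': "R \<union> set P \<subseteq> R'"
  shows "linear_path E (P @ tl Q)" "hd (P @ tl Q) = t" "last (P @ tl Q) = last Q"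
    "set (P @ tl Q) = set P \<union> set Q" "5 \<le> length (P @ tl Q)" "set (P @ tl Q) \<inter> R = {t}"
proof -
  have "P \<noteq> []" using P(3) by auto
  have "set P \<inter> set Q = {hd Q}" using Q(2,4) R' \<open>P \<noteq> []\<close> last_in_set[of P] by auto
  note a = linear_path_append[OF P(1) Q(1) Q(2)[symmetric] this]
  show "linear_path E (P @ tl Q)" "hd (P @ tl Q) = t" "last (P @ tl Q) = last Q"
    "set (P @ tl Q) = set P \<union> set Q" "5 \<le> length (P @ tl Q)"
    using a P(2,3) Q(3) by auto
  have "set Q \<inter> R \<subseteq> {t}"
  proof
    fix v assume v: "v \<in> set Q \<inter> R"
    then have "v \<in> set Q \<inter> R'" using R' by auto
    then have "v = last P" unfolding Q(4) by simp
    then have "v \<in> set P \<inter> R" using v \<open>P \<noteq> []\<close> last_in_set[of P] by simp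
    then show "v \<in> {t}" unfolding P(4) .
  qed
  then show "set (P @ tl Q) \<inter> R = {t}" unfolding a(4) using P(4) by blast
qed

lemma returns_prepend:
  assumes "linear_path E P" "hd P = t" "3 \<le> length P" "set P \<inter> R = {t}"
    and "returns R' (last P) S" "R \<union> set P \<subseteq> R'"
  shows "returns R t S"
proof -
  obtain Q \<alpha> \<beta> where Q: "linear_path E Q" "hd Q = last P" "3 \<le> length Q" "set Q \<inter> R' = {last P}"
    "{last Q, \<alpha>, \<beta>} \<in> E" "{\<alpha>, \<beta>} \<in> S"
    using assms(5) by (auto simp: returns_def)
  note e = path_extend[OF assms(1-4) Q(1-4) assms(6)]
  show ?thesis unfolding returns_def
    using e Q(5,6) by (intro exI[of _ "P @ tl Q"] exI[of _ \<alpha>] exI[of _ \<beta>]) auto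
qed

text \<open>A returning edge with exactly one of \<open>t\<close>, \<open>s\<close> closes the path
  from that vertex over \<open>{t, s, u}\<close> and along \<open>Q\<close>. Otherwise it contains
  the new base \<open>{t, s}\<close>, or it misses both and the hypothesis applies to the path
  prolonged back to \<open>t\<close>.\<close>

lemma blocked_edge:
  assumes b: "blocked R t S" and e: "{t, s, u} \<in> E" and R: "t \<in> R" "s \<notin> R" "u \<notin> R"
  shows "blocked (R \<union> {s, u}) u (insert {t, s} S)"
  unfolding blocked_def
proof (intro allI impI)
  fix Q \<alpha> \<beta> assume Q: "linear_path E Q" "hd Q = u" "3 \<le> length Q" "set Q \<inter> (R \<union> {s, u}) = {u}"
    and h: "{last Q, \<alpha>, \<beta>} \<in> E" "{\<alpha>, \<beta>} \<inter> set Q = {}" "{\<alpha>, \<beta>} \<inter> (R \<union> {s, u}) \<noteq> {}"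
  have ed: "t \<noteq> s" "s \<noteq> u" "t \<noteq> u" "\<alpha> \<noteq> \<beta>" using edge_distinct[OF e] edge_distinct[OF h(1)] by auto
  have uQ: "u \<in> set Q" using Q(4) by blast
  have P: "linear_path E [t, s, u]" "linear_path E [s, t, u]"
    using e ed by (auto simp: linear_path_def insert_commute)
  have i: "set [t, s, u] \<inter> R = {t}" "set [s, t, u] \<inter> {s} = {s}" using R by auto
  have x: "linear_path E ([t, s, u] @ tl Q)" "hd ([t, s, u] @ tl Q) = t"
    "last ([t, s, u] @ tl Q) = last Q" "set ([t, s, u] @ tl Q) = set [t, s, u] \<union> set Q"
    "5 \<le> length ([t, s, u] @ tl Q)" "set ([t, s, u] @ tl Q) \<inter> R = {t}"
    by (rule path_extend[OF P(1) _ _ i(1) Q(1) _ Q(3), of "R \<union> {s, u}"]; use Q R in auto)+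
  have y: "linear_path E ([s, t, u] @ tl Q)" "hd ([s, t, u] @ tl Q) = s"
    "last ([s, t, u] @ tl Q) = last Q" "set ([s, t, u] @ tl Q) = set [s, t, u] \<union> set Q"
    "5 \<le> length ([s, t, u] @ tl Q)" "set ([s, t, u] @ tl Q) \<inter> {s} = {s}"
    by (rule path_extend[OF P(2) _ _ i(2) Q(1) _ Q(3), of "R \<union> {s, u}"]; use Q R in auto)+
  have 1: "z = t" if "{last Q, s, z} \<in> E" "z \<notin> set Q" for z
  proof (rule ccontr)
    assume "z \<noteq> t"
    moreover have "z \<in> set ([s, t, u] @ tl Q)"
      using no_closing_edge[OF y(1,5), of z, unfolded y(2,3)] that(1) by (simp add: insert_commute)
    moreover have "z \<noteq> s" using edge_distinct[OF that(1)] by auto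
    ultimately show False using y(4) Q R that(2) by auto
  qed
  have 2: "z = s" if "{last Q, t, z} \<in> E" "z \<notin> set Q" for z
  proof (rule ccontr)
    assume "z \<noteq> s"
    moreover have "z \<in> set ([t, s, u] @ tl Q)"
      using no_closing_edge[OF x(1,5), of z, unfolded x(2,3)] that(1) by (simp add: insert_commute)
    moreover have "z \<noteq> t" using edge_distinct[OF that(1)] by auto
    ultimately show False using x(4) Q R that(2) by auto
  qed
  show "{\<alpha>, \<beta>} \<in> insert {t, s} S"
  proof (cases "{\<alpha>, \<beta>} = {t, s}")
    case False
    have h': "{last Q, \<beta>, \<alpha>} \<in> E" using h(1) by (simp add: insert_commute)
    have n: "\<alpha> \<noteq> s" "\<alpha> \<noteq> t" "\<beta> \<noteq> s" "\<beta> \<noteq> t"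
    proof -
      have "\<alpha> = s \<Longrightarrow> \<beta> = t" "\<alpha> = t \<Longrightarrow> \<beta> = s" using 1[of \<beta>] 2[of \<beta>] h(1,2) by simp_all
      moreover have "\<beta> = s \<Longrightarrow> \<alpha> = t" "\<beta> = t \<Longrightarrow> \<alpha> = s" using 1[of \<alpha>] 2[of \<alpha>] h' h(2) by simp_all
      moreover have "\<not> (\<alpha> = s \<and> \<beta> = t)" "\<not> (\<alpha> = t \<and> \<beta> = s)"
        using False by (auto simp: insert_commute)
      ultimately show "\<alpha> \<noteq> s" "\<alpha> \<noteq> t" "\<beta> \<noteq> s" "\<beta> \<noteq> t" by blast+
    qed
    have "{\<alpha>, \<beta>} \<in> S"
      using b[unfolded blocked_def, rule_format, of "[t, s, u] @ tl Q" \<alpha> \<beta>] x Q R h n uQ by auto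
    then show ?thesis by simp
  qed simp
qed

text \<open>If a returning edge has a vertex in \<open>B\<close>, the gadget path from one of its
  vertices to \<open>w\<close>, continued by \<open>Q\<close>, closes to a linear cycle. Otherwise
  prepending \<open>P\<close> reduces to the hypothesis at \<open>t\<close>, so no base is
  added.\<close>

lemma blocked_gadget:
  assumes b: "blocked R t S" and g: "gadget E B w" and R: "B \<inter> R = {t}"
    and P: "linear_path E P" "hd P = t" "last P = w" "3 \<le> length P" "set P \<subseteq> B"
  shows "blocked (R \<union> B) w S"
  unfolding blocked_def
proof (intro allI impI)
  fix Q \<alpha> \<beta> assume Q: "linear_path E Q" "hd Q = w" "3 \<le> length Q" "set Q \<inter> (R \<union> B) = {w}"
    and h: "{last Q, \<alpha>, \<beta>} \<in> E" "{\<alpha>, \<beta>} \<inter> set Q = {}" "{\<alpha>, \<beta>} \<inter> (R \<union> B) \<noteq> {}"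
  have wQ: "w \<in> set Q" using Q(4) by blast
  have wB: "w \<in> B" using g by (simp add: gadget_def)
  have h': "{last Q, \<beta>, \<alpha>} \<in> E" using h(1) by (simp add: insert_commute)
  have cyc: False if e: "{last Q, z, z'} \<in> E" "z \<notin> set Q" "z' \<notin> set Q" and z: "z' \<notin> set P'"
    and P': "linear_path E P'" "set P' \<subseteq> B" "last P' = w" "hd P' = z" for P' z z'
  proof -
    have ne: "P' \<noteq> []" using P'(1) by (auto simp: linear_path_def)
    have "z \<noteq> w" using e(2) wQ by auto
    then have len: "3 \<le> length P'"
      using P' chain_odd[of E P'] ne
      by (cases P'; cases "tl P'"; cases "tl (tl P')") (auto simp: linear_path_def)
    have "z \<in> set P'" using P'(4) ne hd_in_set by auto
    then have i: "set P' \<inter> {z} = {z}" "{z} \<union> set P' \<subseteq> R \<union> B" using P'(2) by auto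
    have x: "linear_path E (P' @ tl Q)" "hd (P' @ tl Q) = z" "last (P' @ tl Q) = last Q"
      "5 \<le> length (P' @ tl Q)"
      by (rule path_extend[OF P'(1,4) len i(1) Q(1) _ Q(3) _ i(2)]; use P'(3) Q in simp)+
    have "z' \<in> set (P' @ tl Q)"
      using no_closing_edge[OF x(1,4), of z', unfolded x(2,3)] e(1) by (simp add: insert_commute)
    then show False using z e(3) by (cases Q) auto
  qed
  have gad: False if z: "{last Q, z, z'} \<in> E" "z \<notin> set Q" "z' \<notin> set Q" "z \<in> B" for z z'
  proof -
    have "z \<noteq> z'" "z \<noteq> w" "z' \<noteq> w" using edge_distinct[OF z(1)] z wQ by auto
    then obtain P' where "linear_path E P'" "set P' \<subseteq> B" "last P' = w"
      "hd P' = z \<and> z' \<notin> set P' \<or> hd P' = z' \<and> z \<notin> set P'"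
      using g z(4) unfolding gadget_def by blast
    moreover have "{last Q, z', z} \<in> E" using z(1) by (simp add: insert_commute)
    ultimately show False using cyc[of z z' P'] cyc[of z' z P'] z by blast
  qed
  have n: "\<alpha> \<notin> B" "\<beta> \<notin> B" using gad[OF h(1)] gad[OF h'] h(2) by auto
  have i: "set P \<inter> R = {t}" using P(2,4,5) R hd_in_set[of P] by fastforce
  have "R \<union> set P \<subseteq> R \<union> B" using P(5) by auto
  note x = path_extend[OF P(1,2,4) i Q(1) _ Q(3) _ this, unfolded P(3), OF Q(2,4)]
  show "{\<alpha>, \<beta>} \<in> S"
  proof (rule b[unfolded blocked_def, rule_format, OF x(1,2) _ x(6), unfolded x(3,4)])
    show "3 \<le> length (P @ tl Q)" using x(5) by simp
    show "{\<alpha>, \<beta>} \<inter> (set P \<union> set Q) = {}" using h(2) n P(5) by auto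
    show "{\<alpha>, \<beta>} \<inter> R \<noteq> {}" using h(3) n by auto
  qed (rule h(1))
qed

text \<open>Induction on the number of unused vertices: extend the search by the edge \<open>{t, s, u}\<close>. If the
  continuation returns to \<open>{t, s}\<close> rather than to \<open>S\<close>, absorb the resulting lollipop into
  \<open>R\<close> and continue from its exit, now without \<open>{t, s}\<close> among the bases.\<close>

lemma returns_if_blocked:
  assumes "finite V" "\<Union>E \<subseteq> V" "\<forall>v \<in> \<Union>E - R. three_matching E v"
    "blocked R t S" "t \<in> R" "{t, s, u} \<in> E" "s \<notin> R" "u \<notin> R"
  shows "returns R t S"
  using assms(3-)
proof (induction "card (V - R)" arbitrary: R t S s u rule: less_induct)
  case less
  note prems = less.prems
  have ed: "t \<noteq> s" "s \<noteq> u" "t \<noteq> u" using edge_distinct[OF prems(4)] by auto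
  have smaller: "card (V - R') < card (V - R)" if "R \<subseteq> R'" "v \<in> R'" "v \<notin> R" "v \<in> \<Union>E" for R' v
    using that assms(1,2) by (intro psubset_card_mono) auto
  have P: "linear_path E [t, s, u]" using prems(4) ed by (simp add: linear_path_def)
  have i: "set [t, s, u] \<inter> R = {t}" using prems by auto
  have "three_matching E u" using prems by auto
  \<comment> \<open>Avoiding \<open>t\<close> and \<open>s\<close> makes this edge meet
    \<open>{t, s, u}\<close> only in \<open>u\<close>.\<close>
  then obtain p q where pq: "{u, p, q} \<in> E" "{p, q} \<inter> {t, s} = {}" by (rule three_matching_edge)
  show ?case
  proof (cases "{p, q} \<inter> R = {}")
    case False
    then have "{p, q} \<in> S"
      using prems(2)[unfolded blocked_def, rule_format, of "[t, s, u]" p q] P i pq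
        edge_distinct[OF pq(1)] by auto
    then show ?thesis using P i pq(1) unfolding returns_def
      by (intro exI[of _ "[t, s, u]"] exI[of _ p] exI[of _ q]) auto
  next
    case True
    let ?R = "R \<union> {s, u}"
    have "card (V - ?R) < card (V - R)"
      by (rule smaller[of _ s]) (use prems(4,5) in \<open>auto intro!: bexI[of _ "{t, s, u}"]\<close>)
    then have "returns ?R u (insert {t, s} S)"
      using prems blocked_edge[OF prems(2,4,3,5,6)] pq True
        edge_distinct[OF pq(1)]
      by (intro less.hyps[of ?R u "insert {t, s} S" p q]) auto
    then obtain Q \<alpha> \<beta> where Q: "linear_path E Q" "hd Q = u" "3 \<le> length Q" "set Q \<inter> ?R = {u}"
      "{last Q, \<alpha>, \<beta>} \<in> E" "{\<alpha>, \<beta>} \<in> insert {t, s} S"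
      by (auto simp: returns_def)
    show ?thesis
    proof (cases "{\<alpha>, \<beta>} = {t, s}")
      case False
      then have "returns ?R u S" using Q unfolding returns_def by auto
      then show ?thesis using returns_prepend[OF P _ _ i, of ?R] prems by auto
    next
      case True
      define B where "B = set (t # s # Q)"
      have "Q \<noteq> []" using Q(3) by auto
      then obtain Q' where Q': "Q = u # Q'" using Q(2) by (metis list.collapse)
      have "{last Q, t, s} \<in> E" using Q(5) True by (metis insert_is_Un)
      moreover have "linear_path E (t # s # Q)"
        using Q(1,4) prems ed Q' by (auto simp: linear_path_def)
      ultimately have L: "lollipop E t s Q" using Q(3) by (simp add: lollipop_def)
      have inE: "v \<in> \<Union>E - R" if "v \<in> set (s # Q)" for v
      proof
        have "chain E (t # s # Q)" using L by (simp add: lollipop_def linear_path_def)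
        then show "v \<in> \<Union>E" using chain_vertices[of E "t # s # Q"] that Q(3) by auto
        show "v \<notin> R" using that Q(4) prems(5,6) by auto
      qed
      then obtain w p' q' where w: "w \<in> B" "w \<noteq> t" "gadget E B w" "{w, p', q'} \<in> E" "{p', q'} \<inter> B = {}"
        using lollipop_exit[OF L _ B_def] prems(1) by blast
      have BR: "B \<inter> R = {t}" using Q(4) prems by (auto simp: B_def)
      have "t \<in> B" by (simp add: B_def)
      \<comment> \<open>With \<open>p'\<close> as \<beta>, which lies outside \<open>B\<close>, the
        gadget path can only start at \<open>t\<close>.\<close>
      then obtain P' where P': "linear_path E P'" "set P' \<subseteq> B" "last P' = w" "hd P' = t"
        using w unfolding gadget_def by (metis disjoint_iff hd_in_set insertCI linear_path_def chain.simps(1) subsetD)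
      have len: "3 \<le> length P'" using P' w(2) chain_odd[of E P']
        by (cases P'; cases "tl P'"; cases "tl (tl P')") (auto simp: linear_path_def)
      have i': "set P' \<inter> R = {t}" using P' BR len hd_in_set[of P'] by fastforce
      show ?thesis
      proof (cases "{p', q'} \<inter> R = {}")
        case False
        then have "{p', q'} \<in> S"
          using prems(2)[unfolded blocked_def, rule_format, of P' p' q'] P' len i' w(4,5) by auto
        then show ?thesis using P' len i' w(4) unfolding returns_def by blast
      next
        case True
        have "returns (R \<union> B) w S"
          using smaller[of "R \<union> B" s] inE[of s] prems(1,5) w True BR
            blocked_gadget[OF prems(2) w(3) BR P'(1,4,3) len P'(2)]
          by (intro less.hyps[of "R \<union> B" w S p' q']) (auto simp: B_def)
        then show ?thesis using returns_prepend[OF P'(1,4) len i', of "R \<union> B"] P' by auto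
      qed
    qed
  qed
qed

text \<open>The given edge starts the search at \<open>r\<close>, so the link of \<open>r\<close>
  itself may be poor; with no base to return to, the search cannot end.\<close>

lemma no_three_matchings:
  assumes "finite E" "{r, s, u} \<in> E"
  shows "\<exists>v \<in> \<Union>E - {r}. \<not> three_matching E v"
proof (rule ccontr)
  assume "\<not> ?thesis"
  moreover have "finite (\<Union>E)" using assms(1) uniform by (metis finite_Union card.infinite zero_neq_numeral)
  \<comment> \<open>Vacuous, since a pair disjoint from \<open>set Q\<close> cannot contain
    \<open>r\<close>.\<close>
  moreover have "blocked {r} r {}" by (auto simp: blocked_def)
  ultimately have "returns {r} r {}"
    using returns_if_blocked[of "\<Union>E" "{r}" r "{}" s u] assms(2) edge_distinct[OF assms(2)] by auto
  then show False by (simp add: returns_def)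
qed

end

section \<open>Choice of the root\<close>

theorem theorem1p4:
  fixes V :: "'a set" and E :: "'a set set"
  assumes "three_uniform_hypergraph V E"
    and "card V \<ge> 2"
    and "card {v \<in> V. \<not> strong_degree E v \<ge> 3} \<le> 1"
  shows "\<exists>C. C \<subseteq> E \<and> linear_cycle C"
proof (rule ccontr)
  assume nc: "\<nexists>C. C \<subseteq> E \<and> linear_cycle C"
  have fV: "finite V" and sub: "\<And>e. e \<in> E \<Longrightarrow> e \<subseteq> V" and c3: "\<And>e. e \<in> E \<Longrightarrow> card e = 3"
    using assms(1) by (auto simp: three_uniform_hypergraph_def)
  interpret linear_cycle_free E by unfold_locales (use c3 nc in auto)
  let ?X = "{v \<in> V. \<not> strong_degree E v \<ge> 3}"
  have "finite E" using sub fV by (meson Pow_iff finite_Pow_iff finite_subset subsetI)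
  have "\<forall>a \<in> ?X. \<forall>b \<in> ?X. a = b" using assms(3) fV card_le_Suc0_iff_eq[of ?X] by simp
  then obtain z where z: "?X \<subseteq> {z}" by blast
  have m: "three_matching E v" if "v \<in> V" "v \<noteq> z" for v
    using that z strong_degree_three_matching[OF assms(1), of v] by auto
  have ex: "\<exists>s u. {v, s, u} \<in> E" if "three_matching E v" for v
    using three_matching_edge[OF that] by metis
  \<comment> \<open>If \<open>z\<close> lies in an edge, it becomes the root; otherwise any other
    vertex serves, and \<open>card V \<ge> 2\<close> provides one.\<close>
  have "\<exists>r s u. {r, s, u} \<in> E \<and> (\<forall>v \<in> \<Union>E - {r}. three_matching E v)"
  proof (cases "z \<in> \<Union>E")
    case True
    then obtain e where e: "z \<in> e" "e \<in> E" by auto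
    then obtain s u where "e = {z, s, u}" using c3[of e] by (auto simp: card_3_iff)
    then show ?thesis using e(2) m sub by blast
  next
    case False
    have "\<not> V \<subseteq> {z}" using assms(2) card_mono[of "{z}" V] by auto
    then obtain r where r: "r \<in> V" "r \<noteq> z" by auto
    then obtain s u where "{r, s, u} \<in> E" using ex m by blast
    moreover have "three_matching E v" if "v \<in> \<Union>E" for v using that False m sub by blast
    ultimately show ?thesis by blast
  qed
  then show False using no_three_matchings[OF \<open>finite E\<close>] by blast
qed

end
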